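(* Let $\varepsilon>0$. Let $(z_n)_{n\ge1}$ be complex numbers with $z_1\neq 0$ and $|z_n|\le|z_1|$ for all $n\ge1$, and let $(b_n)_{n\ge1}$ be non-negative real numbers with $b_1>0$. Set $$M=b_1^{-1}\sum_{n\ge1}\frac{b_n|z_n|}{|z_1|+|z_n|},$$ assumed finite, and for $j\in\mathbb{N}$ set $s_j=\sum_{n\ge1}b_nz_n^j$. Then there exists an integer $j$ with $1\le j\le (8+\varepsilon)M$ such that $$\Re(s_j)\ge \frac{b_1\varepsilon}{32+4\varepsilon}|z_1|^j.$$ *)

theory Defs
  imports "HOL-Analysis.Infinite_Sum"
begin

end

theory Submission
  imports Defs "HOL-Complex_Analysis.Conformal_Mappings"
begin

text \<open>
  After scaling to \<open>\<bar>z\<^sub>1\<bar> = 1\<close>, average the real parts of the power sums \<open>s\<^sub>j\<close> against the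
  weights \<open>(1 - j/N) (1 + cos (j arg z\<^sub>1))\<close>, where \<open>N - 1 = \<lfloor>(8 + \<epsilon>) M\<rfloor>\<close>. The Fejer kernel is a
  nonnegative trigonometric polynomial, so Harnack's inequality shows that a point of modulus \<open>r\<close>
  contributes at least \<open>-2r/(1 + r)\<close> times its coefficient, whereas the resonance at \<open>z\<^sub>1\<close> gains an
  additional \<open>N/4\<close>. The weights have total mass at most \<open>N - 1\<close>, so not all \<open>s\<^sub>j\<close> with \<open>j < N\<close>
  can have a small real part.
\<close>

section \<open>Positivity of the Fejer kernel on the unit circle\<close>

definition fejer_poly :: "nat \<Rightarrow> complex \<Rightarrow> complex" where
  "fejer_poly N w = (\<Sum>j\<in>{1..<N}. of_real (1 - real j / real N) * w ^ j)"

text \<open>Induction on \<open>N\<close>: appending \<open>w ^ N\<close> to the geometric sum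
  changes its squared modulus by 1 plus twice a cross term, and on the circle that cross term
  collapses to the sum of \<open>Re (w ^ j)\<close> over 1 \<le> j \<le> N. This is exactly the
  effect of raising every weight \<open>N - j\<close> by one.\<close>

lemma sum_Re_unit_circle:
  fixes w :: complex
  assumes "norm w = 1"
  shows "real N + 2 * (\<Sum>j\<in>{1..<N}. (real N - real j) * Re (w ^ j)) = (norm (\<Sum>k<N. w ^ k))\<^sup>2"
proof (induction N)
  case 0
  then show ?case by simp
next
  case (Suc N)
  have wc: "w * cnj w = 1"
    using assms by (simp add: complex_norm_square[symmetric])
  have pw: "w ^ k * cnj (w ^ N) = cnj (w ^ (N - k))" if "k < N" for k
  proof -
    have "w ^ k * cnj (w ^ N) = (w * cnj w) ^ k * cnj (w ^ (N - k))"
      using that by (simp add: power_mult_distrib mult.assoc flip: power_add)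
    then show ?thesis using wc by simp
  qed
  have "Re ((\<Sum>k<N. w ^ k) * cnj (w ^ N)) = (\<Sum>k<N. Re (w ^ (N - k)))"
    by (simp add: sum_distrib_right pw del: complex_cnj_power)
  also have "\<dots> = (\<Sum>j\<in>{1..N}. Re (w ^ j))"
    by (rule sum.reindex_bij_witness[of _ "\<lambda>j. N - j" "\<lambda>k. N - k"]) auto
  finally have cross: "Re ((\<Sum>k<N. w ^ k) * cnj (w ^ N)) = (\<Sum>j\<in>{1..N}. Re (w ^ j))" .
  have sq: "(norm (a + c))\<^sup>2 = (norm a)\<^sup>2 + 2 * Re (a * cnj c) + (norm c)\<^sup>2" for a c :: complex
    unfolding cmod_power2 by (simp add: power2_eq_square algebra_simps)
  have "(norm (\<Sum>k<Suc N. w ^ k))\<^sup>2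
      = (norm (\<Sum>k<N. w ^ k))\<^sup>2 + 2 * (\<Sum>j\<in>{1..N}. Re (w ^ j)) + 1"
    using assms cross by (simp add: sq norm_power)
  moreover have "(\<Sum>j\<in>{1..<Suc N}. (real (Suc N) - real j) * Re (w ^ j))
      = (\<Sum>j\<in>{1..N}. (real N - real j) * Re (w ^ j)) + (\<Sum>j\<in>{1..N}. Re (w ^ j))"
    by (simp add: atLeastLessThanSuc_atLeastAtMost algebra_simps flip: sum.distrib)
  moreover have "(\<Sum>j\<in>{1..N}. (real N - real j) * Re (w ^ j))
      = (\<Sum>j\<in>{1..<N}. (real N - real j) * Re (w ^ j))"
    by (rule sum.mono_neutral_right) auto
  ultimately show ?case using Suc.IH by (simp add: algebra_simps)
qed

text \<open>On the circle this real part is the Fejer kernel, \<open>1/N\<close> times the square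
  above. Being the real part of a polynomial, it extends harmonically to the disc.\<close>

lemma Re_fejer_poly_unit_circle:
  assumes "norm w = 1" and "N > 0"
  shows "Re (1 + 2 * fejer_poly N w) \<ge> 0"
proof -
  have "real N * Re (fejer_poly N w) = (\<Sum>j\<in>{1..<N}. (real N - real j) * Re (w ^ j))"
    using assms(2) unfolding fejer_poly_def
    by (simp add: sum_distrib_left divide_simps del: of_real_diff of_real_divide)
  then have "real N * Re (1 + 2 * fejer_poly N w) = (norm (\<Sum>k<N. w ^ k))\<^sup>2"
    using sum_Re_unit_circle[OF assms(1), of N] by (simp add: algebra_simps)
  then have "real N * Re (1 + 2 * fejer_poly N w) \<ge> 0" by simp
  then show ?thesis using assms(2) by (simp only: zero_le_mult_iff) auto
qed

section \<open>Harnack's inequality and the lower bound inside the disc\<close>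

lemma maximum_modulus_unit_disc:
  assumes "f holomorphic_on S" and "cball 0 1 \<subseteq> S"
    and "\<And>w. norm w = 1 \<Longrightarrow> norm (f w) \<le> B" and "norm \<xi> \<le> 1"
  shows "norm (f \<xi>) \<le> B"
proof (rule maximum_modulus_frontier[where S = "cball 0 1" and f = f])
  have hol: "f holomorphic_on cball 0 1"
    using assms(1,2) holomorphic_on_subset by blast
  show "f holomorphic_on interior (cball 0 1)"
    using hol holomorphic_on_subset interior_subset by blast
  show "continuous_on (closure (cball 0 1)) f"
    using hol holomorphic_on_imp_continuous_on by simp
qed (use assms in \<open>auto simp: dist_norm\<close>)

text \<open>The modulus of \<open>exp (- f w)\<close> is the exponential of
  \<open>- Re (f w)\<close>, so the maximum modulus principle turns into a minimum principle for the
  real part.\<close>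

lemma Re_nonneg_unit_disc:
  assumes hol: "f holomorphic_on UNIV"
    and circle: "\<And>w. norm w = 1 \<Longrightarrow> Re (f w) \<ge> 0" and "norm \<xi> \<le> 1"
  shows "Re (f \<xi>) \<ge> 0"
proof -
  have "norm (exp (- f \<xi>)) \<le> 1"
    by (rule maximum_modulus_unit_disc[where S = UNIV and f = "\<lambda>w. exp (- f w)"])
      (use assms in \<open>auto intro!: holomorphic_intros\<close>)
  then show ?thesis by simp
qed

text \<open>Schwarz's lemma for the Cayley transform \<open>(F - 1) / (F + 1)\<close> of
  \<open>F = 1 + w * g w\<close>. This form of \<open>F\<close> exhibits the zero of
  \<open>F - 1\<close> at the origin, so a factor \<open>w\<close> can be divided out with no
  removable singularity to treat.\<close>

lemma harnack_unit_disc: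
  assumes holg: "g holomorphic_on UNIV"
    and circle: "\<And>w. norm w = 1 \<Longrightarrow> Re (1 + w * g w) \<ge> 0" and "norm \<xi> \<le> 1"
  shows "Re (1 + \<xi> * g \<xi>) \<ge> (1 - norm \<xi>) / (1 + norm \<xi>)"
proof -
  have pos: "Re (1 + w * g w) \<ge> 0" if "norm w \<le> 1" for w
    by (rule Re_nonneg_unit_disc) (use assms that in \<open>auto intro!: holomorphic_intros\<close>)
  have nz: "2 + w * g w \<noteq> 0" if "norm w \<le> 1" for w
  proof
    assume "2 + w * g w = 0"
    then have "1 + w * g w = -1" by (simp add: algebra_simps eq_neg_iff_add_eq_0)
    with pos[OF that] show False by simp
  qed
  \<comment> \<open>The two sides differ by \<open>4 * Re F\<close>.\<close>
  have le: "(norm (F - 1))\<^sup>2 \<le> (norm (F + 1))\<^sup>2" if "Re F \<ge> 0" for F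
    using that unfolding cmod_power2 by (simp add: power2_eq_square algebra_simps)
  have "norm (g \<xi> / (2 + \<xi> * g \<xi>)) \<le> 1"
  proof (rule maximum_modulus_unit_disc[where S = "cball 0 1" and f = "\<lambda>w. g w / (2 + w * g w)"])
    have "g holomorphic_on cball 0 1"
      using holg holomorphic_on_subset by blast
    then show "(\<lambda>w. g w / (2 + w * g w)) holomorphic_on cball 0 1"
      by (intro holomorphic_intros) (use nz in auto)
    show "norm (g w / (2 + w * g w)) \<le> 1" if w: "norm w = 1" for w
    proof -
      have "(norm (w * g w))\<^sup>2 \<le> (norm (2 + w * g w))\<^sup>2"
        using le[OF circle[OF w]] by (simp add: add.commute add.left_commute)
      then show ?thesis using w nz[of w]
        by (simp add: norm_mult norm_divide divide_simps)
    qed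
  qed (use assms in auto)
  then have "norm (g \<xi>) \<le> norm (2 + \<xi> * g \<xi>)"
    using nz[OF assms(3)] by (simp add: norm_divide divide_simps)
  then have bound: "norm (\<xi> * g \<xi>) \<le> norm \<xi> * norm (2 + \<xi> * g \<xi>)"
    by (simp add: norm_mult mult_left_mono)
  define F where "F = 1 + \<xi> * g \<xi>"
  define r where "r = norm \<xi>"
  have r: "0 \<le> r" "r \<le> 1" using assms by (auto simp: r_def)
  have "norm (F - 1) \<le> r * norm (F + 1)"
    using bound by (simp add: F_def r_def add.commute add.left_commute)
  have Fp: "Re F \<ge> 0" using pos assms by (simp add: F_def)
  have "(norm (F - 1))\<^sup>2 \<le> (r * norm (F + 1))\<^sup>2"
    using \<open>norm (F - 1) \<le> _\<close> by (intro power_mono) auto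
  then have "(Re F - 1)\<^sup>2 + (Im F)\<^sup>2 \<le> r\<^sup>2 * ((Re F + 1)\<^sup>2 + (Im F)\<^sup>2)"
    by (simp add: power_mult_distrib cmod_power2)
  \<comment> \<open>Since r \<le> 1, the imaginary parts cancel in the favourable direction, leaving
    an inequality in \<open>Re F\<close> alone.\<close>
  moreover have "r\<^sup>2 * (Im F)\<^sup>2 \<le> (Im F)\<^sup>2"
    using r by (simp add: mult_left_le_one_le power_le_one)
  ultimately have "(1 - Re F)\<^sup>2 \<le> (r * (Re F + 1))\<^sup>2"
    unfolding power_mult_distrib[of r] power2_commute[of 1 "Re F"] distrib_left[of "r\<^sup>2"]
    by linarith
  then have "1 - Re F \<le> r * (Re F + 1)"
    by (rule power2_le_imp_le) (use r Fp in simp)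
  then show ?thesis
    using r unfolding F_def[symmetric] r_def[symmetric] by (simp add: field_simps)
qed

lemma Re_fejer_poly_ge:
  assumes "norm w \<le> 1" and "N > 0"
  shows "Re (fejer_poly N w) \<ge> - norm w / (1 + norm w)"
proof -
  \<comment> \<open>A factor \<open>w\<close> is divided out of \<open>2 * fejer_poly N w\<close>;
    the sum starts at \<open>j = 1\<close>, so \<open>j - 1\<close> is never truncated.\<close>
  define g where "g w = 2 * (\<Sum>j\<in>{1..<N}. of_real (1 - real j / real N) * w ^ (j - 1))" for w :: complex
  have g: "1 + w * g w = 1 + 2 * fejer_poly N w" for w
  proof -
    have "w * g w = 2 * (\<Sum>j\<in>{1..<N}. of_real (1 - real j / real N) * (w * w ^ (j - 1)))"
      by (simp add: g_def sum_distrib_left mult_ac)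
    also have "\<dots> = 2 * fejer_poly N w"
      unfolding fejer_poly_def
      by (intro arg_cong[where f = "\<lambda>x. 2 * x"] sum.cong) (auto simp flip: power_Suc)
    finally show ?thesis by simp
  qed
  have "Re (1 + w * g w) \<ge> (1 - norm w) / (1 + norm w)"
  proof (rule harnack_unit_disc)
    show "g holomorphic_on UNIV"
      unfolding g_def by (intro holomorphic_intros)
  qed (use assms Re_fejer_poly_unit_circle g in auto)
  moreover have "(1 - norm w) / (1 + norm w) = 1 - 2 * norm w / (1 + norm w)"
    by (simp add: divide_simps add_nonneg_eq_0_iff)
  ultimately show ?thesis by (simp add: g)
qed

section \<open>The weighted average of the powers of a single point\<close>

lemma fejer_weights_sum: "(\<Sum>j\<in>{1..<N}. 1 - real j / real N) = (real N - 1) / 2" if "N > 0"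
proof -
  have "(\<Sum>j\<in>{1..<N}. real N - real j) = real N * (real N - 1) / 2" for N
  proof (induction N)
    case (Suc N)
    have "(\<Sum>j\<in>{1..<Suc N}. real (Suc N) - real j) = (\<Sum>j\<in>{1..N}. real N - real j) + real N"
      by (simp add: algebra_simps sum.distrib sum_subtractf atLeastLessThanSuc_atLeastAtMost)
    also have "(\<Sum>j\<in>{1..N}. real N - real j) = (\<Sum>j\<in>{1..<N}. real N - real j)"
      by (rule sum.mono_neutral_right) auto
    finally show ?case using Suc.IH by (simp add: field_simps)
  qed simp
  moreover have "(\<Sum>j\<in>{1..<N}. 1 - real j / real N) = (\<Sum>j\<in>{1..<N}. real N - real j) / real N"
    using that by (simp add: sum_divide_distrib diff_divide_distrib)
  ultimately show ?thesis using that by simp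
qed

text \<open>Product-to-sum: multiplying by \<open>Re (\<zeta> ^ j)\<close> replaces \<open>w\<close>
  by the average over its two rotations \<open>w * \<zeta>\<close> and
  \<open>w * cnj \<zeta>\<close>.\<close>

lemma weighted_fejer_sum:
  "(\<Sum>j\<in>{1..<N}. (1 - real j / real N) * (1 + Re (\<zeta> ^ j)) * Re (w ^ j))
    = Re (fejer_poly N w) + (Re (fejer_poly N (w * \<zeta>)) + Re (fejer_poly N (w * cnj \<zeta>))) / 2"
proof -
  have "Re (\<zeta> ^ j) * Re (w ^ j) = (Re ((w * \<zeta>) ^ j) + Re ((w * cnj \<zeta>) ^ j)) / 2" for j
    by (simp add: power_mult_distrib flip: complex_cnj_power)
  then have "(1 - real j / real N) * (1 + Re (\<zeta> ^ j)) * Re (w ^ j)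
      = (1 - real j / real N) * Re (w ^ j) + ((1 - real j / real N) * Re ((w * \<zeta>) ^ j)
        + (1 - real j / real N) * Re ((w * cnj \<zeta>) ^ j)) / 2" for j
    by (simp add: distrib_left distrib_right mult.assoc add_divide_distrib)
  moreover have "Re (fejer_poly N v) = (\<Sum>j\<in>{1..<N}. (1 - real j / real N) * Re (v ^ j))" for v
    unfolding fejer_poly_def by (simp del: of_real_diff of_real_divide)
  ultimately show ?thesis
    by (simp add: sum.distrib flip: sum_divide_distrib)
qed

text \<open>The three Fejer terms carry weights 1, 1/2, 1/2, which add up to the factor 2. At
  \<open>w = \<zeta>\<close> the argument \<open>w * cnj \<zeta>\<close> equals 1, and its half
  share is \<open>(N - 1) / 4\<close>; with the other two bounds, -1/2 and -1/4, the total is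
  \<open>N / 4 - 1\<close>.\<close>

lemma weighted_fejer_sum_ge:
  assumes "norm \<zeta> = 1" and "norm w \<le> 1" and "N > 0"
  shows "(\<Sum>j\<in>{1..<N}. (1 - real j / real N) * (1 + Re (\<zeta> ^ j)) * Re (w ^ j))
    \<ge> - 2 * (norm w / (1 + norm w)) + (if w = \<zeta> then real N / 4 else 0)"
proof -
  have P: "Re (fejer_poly N w) \<ge> - norm w / (1 + norm w)"
    "Re (fejer_poly N (w * \<zeta>)) \<ge> - norm w / (1 + norm w)"
    "Re (fejer_poly N (w * cnj \<zeta>)) \<ge> - norm w / (1 + norm w)"
    using Re_fejer_poly_ge[of w N] Re_fejer_poly_ge[of "w * \<zeta>" N]
      Re_fejer_poly_ge[of "w * cnj \<zeta>" N] assms by (simp_all add: norm_mult)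
  show ?thesis
  proof (cases "w = \<zeta>")
    case False
    then show ?thesis unfolding weighted_fejer_sum using P by simp argo
  next
    case True
    have "Re (fejer_poly N 1) = (\<Sum>j\<in>{1..<N}. 1 - real j / real N)"
      unfolding fejer_poly_def by (simp del: of_real_diff of_real_divide)
    then have "Re (fejer_poly N (w * cnj \<zeta>)) = (real N - 1) / 2"
      using True assms fejer_weights_sum by (simp add: complex_norm_square[symmetric])
    moreover have "Re (fejer_poly N w) \<ge> - 1 / 2" "Re (fejer_poly N (w * \<zeta>)) \<ge> - 1 / 2"
      using P(1,2) True assms(1) by simp_all
    moreover have "- 2 * (norm w / (1 + norm w)) = - 1"
      using True assms(1) by simp
    ultimately show ?thesis
      unfolding weighted_fejer_sum using True by (simp only: if_True) argo
  qed
qed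

section \<open>Convergence of the power sums\<close>

lemma has_sum_sum:
  fixes f :: "'i \<Rightarrow> 'a \<Rightarrow> 'b::topological_comm_monoid_add"
  assumes "finite I" and "\<And>i. i \<in> I \<Longrightarrow> (f i has_sum S i) A"
  shows "((\<lambda>x. \<Sum>i\<in>I. f i x) has_sum (\<Sum>i\<in>I. S i)) A"
  using assms by (induction I rule: finite_induct) (auto intro!: has_sum_add)

text \<open>Comparison with the series defining \<open>M\<close>: with
  \<open>r = norm (z n)\<close>, R + r \<le> 2 * R bounds \<open>r\<close> by
  \<open>2 * R * (r / (R + r))\<close>, and the other \<open>j - 1\<close> factors \<open>r\<close>
  are at most \<open>R\<close>.\<close>

lemma weighted_power_summable:
  fixes b :: "nat \<Rightarrow> real" and z :: "nat \<Rightarrow> complex"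
  assumes "R > 0" and "\<And>n. n \<in> A \<Longrightarrow> norm (z n) \<le> R" and "\<And>n. n \<in> A \<Longrightarrow> b n \<ge> 0"
    and "(\<lambda>n. b n * norm (z n) / (R + norm (z n))) summable_on A" and "j \<ge> 1"
  shows "(\<lambda>n. of_real (b n) * z n ^ j) summable_on A"
proof (rule abs_summable_summable, rule summable_on_comparison_test)
  show "(\<lambda>n. 2 * R ^ j * (b n * norm (z n) / (R + norm (z n)))) summable_on A"
    using assms(4) by (rule summable_on_cmult_right)
  fix n assume n: "n \<in> A"
  define r where "r = norm (z n)"
  have r: "0 \<le> r" "r \<le> R" using assms n by (auto simp: r_def)
  obtain k where k: "j = Suc k" using assms(5) by (cases j) auto
  have "r ^ k * r \<le> R ^ k * r"
    using r by (intro mult_right_mono power_mono)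
  also have "\<dots> \<le> R ^ k * (2 * R * (r / (R + r)))"
  proof (rule mult_left_mono)
    have "r * r \<le> R * r" using r by (intro mult_right_mono)
    then show "r \<le> 2 * R * (r / (R + r))"
      using assms(1) r by (simp add: field_simps)
  qed (use assms in simp)
  finally have "r ^ j \<le> 2 * R ^ j * (r / (R + r))"
    by (simp add: k mult_ac)
  then have "b n * r ^ j \<le> b n * (2 * R ^ j * (r / (R + r)))"
    using assms n by (intro mult_left_mono) auto
  then show "norm (of_real (b n) * z n ^ j) \<le> 2 * R ^ j * (b n * norm (z n) / (R + norm (z n)))"
    using assms n by (simp add: norm_mult norm_power r_def mult_ac)
qed auto

section \<open>Averaging the power sums to reach a contradiction\<close>

theorem theorem2p2:
  fixes \<epsilon> M :: real and z :: "nat \<Rightarrow> complex" and b :: "nat \<Rightarrow> real" and s :: "nat \<Rightarrow> complex"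
  assumes "\<epsilon> > 0"
    and "z 1 \<noteq> 0"
    and "\<And>n. n \<ge> 1 \<Longrightarrow> norm (z n) \<le> norm (z 1)"
    and "\<And>n. n \<ge> 1 \<Longrightarrow> b n \<ge> 0"
    and "b 1 > 0"
    and "(\<lambda>n. b n * norm (z n) / (norm (z 1) + norm (z n))) summable_on {1..}"
    and "M = inverse (b 1) * (\<Sum>\<^sub>\<infinity>n\<in>{1..}. b n * norm (z n) / (norm (z 1) + norm (z n)))"
    and "\<And>j. j \<ge> 1 \<Longrightarrow> s j = (\<Sum>\<^sub>\<infinity>n\<in>{1..}. of_real (b n) * z n ^ j)"
  shows "\<exists>j::nat. 1 \<le> j \<and> real j \<le> (8 + \<epsilon>) * M \<and>
           Re (s j) \<ge> b 1 * \<epsilon> / (32 + 4 * \<epsilon>) * norm (z 1) ^ j"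
proof (rule ccontr)
  assume contra: "\<not> ?thesis"
  define R where "R = norm (z 1)"
  define \<zeta> where "\<zeta> = z 1 / of_real R"
  define w where "w n = z n / of_real R" for n
  \<comment> \<open>The indices 1 \<le> j < N are then exactly the admissible ones, while
    \<open>N\<close> itself strictly exceeds \<open>(8 + \<epsilon>) * M\<close>.\<close>
  define N where "N = Suc (nat \<lfloor>(8 + \<epsilon>) * M\<rfloor>)"
  define c where "c j = (1 - real j / real N) * (1 + Re (\<zeta> ^ j))" for j
  \<comment> \<open>Chosen so that
    \<open>(8 + \<epsilon>) * M * \<delta> = b 1 * \<epsilon> * M / 4\<close>.\<close>
  define \<delta> where "\<delta> = b 1 * \<epsilon> / (32 + 4 * \<epsilon>)"
  define t where "t n = b n * norm (z n) / (R + norm (z n))" for n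
  have R: "R > 0" using assms(2) by (simp add: R_def)
  have N: "N > 0" by (simp add: N_def)
  have \<zeta>: "norm \<zeta> = 1" using R by (simp add: \<zeta>_def norm_divide R_def)
  have w: "norm (w n) \<le> 1" if "n \<ge> 1" for n
    using assms(3)[OF that] R by (simp add: w_def norm_divide R_def)
  have t_has_sum: "(t has_sum (b 1 * M)) {1..}"
    using has_sum_infsum[OF assms(6)] assms(5)
    by (simp add: assms(7) t_def[abs_def] R_def flip: mult.assoc)
  \<comment> \<open>This ensures that \<open>nat\<close> does not truncate a negative floor in
    \<open>N\<close>.\<close>
  have "M \<ge> 0"
  proof -
    have "b 1 * M \<ge> 0"
      using t_has_sum by (rule has_sum_nonneg) (use assms(4) R in \<open>auto simp: t_def\<close>)
    then show ?thesis using assms(5) by (simp add: zero_le_mult_iff)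
  qed
  then have N_floor: "real N - 1 \<le> (8 + \<epsilon>) * M" "(8 + \<epsilon>) * M < real N"
    using assms(1) real_of_int_floor_add_one_gt[of "(8 + \<epsilon>) * M"]
    by (simp_all add: N_def add.commute)
  have c_nonneg: "c j \<ge> 0" and c_le: "c j \<le> 2 * (1 - real j / real N)" if "j < N" for j
  proof -
    have "\<bar>Re (\<zeta> ^ j)\<bar> \<le> 1"
      using abs_Re_le_cmod[of "\<zeta> ^ j"] \<zeta> by (simp add: norm_power)
    moreover have "1 - real j / real N \<ge> 0" using that by simp
    ultimately show "c j \<ge> 0" "c j \<le> 2 * (1 - real j / real N)"
      unfolding c_def mult.commute[of 2] by (intro mult_nonneg_nonneg mult_left_mono; linarith)+
  qed
  have s_has_sum: "((\<lambda>n. b n * Re (w n ^ j)) has_sum (Re (s j) / R ^ j)) {1..}" if "j \<ge> 1" for j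
  proof -
    have "((\<lambda>n. of_real (b n) * z n ^ j) has_sum s j) {1..}"
      unfolding assms(8)[OF that]
      by (rule has_sum_infsum, rule weighted_power_summable[of R]) (use assms R that in \<open>auto simp: R_def\<close>)
    then have "((\<lambda>n. Re (of_real (b n) * z n ^ j) * inverse (R ^ j)) has_sum (Re (s j) * inverse (R ^ j))) {1..}"
      by (intro has_sum_cmult_left has_sum_Re)
    moreover have "w n ^ j = of_real (inverse (R ^ j)) * z n ^ j" for n
      using R by (simp add: w_def power_divide field_simps)
    then have "b n * Re (w n ^ j) = Re (of_real (b n) * z n ^ j) * inverse (R ^ j)" for n
      by (simp del: of_real_inverse of_real_power)
    ultimately show ?thesis by (simp only: divide_inverse)
  qed
  have upper: "((\<lambda>n. \<Sum>j\<in>{1..<N}. c j * (b n * Re (w n ^ j)))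
      has_sum (\<Sum>j\<in>{1..<N}. c j * (Re (s j) / R ^ j))) {1..}"
    by (intro has_sum_sum has_sum_cmult_right s_has_sum) auto
  have lower: "((\<lambda>n. - 2 * t n + (if n = 1 then b 1 * real N / 4 else 0))
      has_sum (- 2 * (b 1 * M) + b 1 * real N / 4)) {1..}"
  proof (intro has_sum_add has_sum_cmult_right t_has_sum)
    show "((\<lambda>n::nat. if n = 1 then b 1 * real N / 4 else 0) has_sum b 1 * real N / 4) {1..}"
      by (rule has_sum_finite_neutralI[of "{1}"]) auto
  qed
  have "- 2 * t n + (if n = 1 then b 1 * real N / 4 else 0)
      \<le> (\<Sum>j\<in>{1..<N}. c j * (b n * Re (w n ^ j)))" if n: "n \<in> {1..}" for n
  proof -
    have "norm (w n) / (1 + norm (w n)) = norm (z n) / (R + norm (z n))"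
      using R by (simp add: w_def norm_divide divide_simps)
    then have "t n = b n * (norm (w n) / (1 + norm (w n)))"
      by (simp add: t_def)
    \<comment> \<open>Only an inequality: further \<open>n\<close> may have
      \<open>z n = z 1\<close>, and their nonnegative gain is dropped.\<close>
    moreover have "(if n = 1 then b 1 * real N / 4 else 0) \<le> b n * (if w n = \<zeta> then real N / 4 else 0)"
      using n assms(4) by (auto simp: w_def \<zeta>_def)
    ultimately have "- 2 * t n + (if n = 1 then b 1 * real N / 4 else 0)
        \<le> b n * (- 2 * (norm (w n) / (1 + norm (w n))) + (if w n = \<zeta> then real N / 4 else 0))"
      unfolding distrib_left by linarith
    also have "\<dots> \<le> b n * (\<Sum>j\<in>{1..<N}. c j * Re (w n ^ j))"
      unfolding c_def using weighted_fejer_sum_ge[OF \<zeta> w N, of n] n assms(4)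
      by (intro mult_left_mono) auto
    also have "\<dots> = (\<Sum>j\<in>{1..<N}. c j * (b n * Re (w n ^ j)))"
      by (simp add: sum_distrib_left mult_ac)
    finally show ?thesis .
  qed
  then have "- 2 * (b 1 * M) + b 1 * real N / 4 \<le> (\<Sum>j\<in>{1..<N}. c j * (Re (s j) / R ^ j))"
    by (rule has_sum_mono[OF lower upper])
  also have "\<dots> \<le> (\<Sum>j\<in>{1..<N}. 2 * (1 - real j / real N) * \<delta>)"
  proof (rule sum_mono)
    fix j assume j: "j \<in> {1..<N}"
    then have "real j \<le> (8 + \<epsilon>) * M" using N_floor(1) by simp
    then have "Re (s j) \<le> \<delta> * R ^ j"
      using contra j unfolding R_def \<delta>_def by (metis atLeastLessThan_iff linear)
    then have "Re (s j) / R ^ j \<le> \<delta>" using R by (simp add: divide_simps)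
    then have "c j * (Re (s j) / R ^ j) \<le> c j * \<delta>"
      using c_nonneg j by (intro mult_left_mono) auto
    also have "\<dots> \<le> 2 * (1 - real j / real N) * \<delta>"
      using c_le j assms(1,5) by (intro mult_right_mono) (auto simp: \<delta>_def)
    finally show "c j * (Re (s j) / R ^ j) \<le> 2 * (1 - real j / real N) * \<delta>" .
  qed
  also have "\<dots> = (real N - 1) * \<delta>"
    by (simp only: fejer_weights_sum[OF N] sum_distrib_left[symmetric] sum_distrib_right[symmetric])
  also have "\<dots> \<le> (8 + \<epsilon>) * M * \<delta>"
    using N_floor(1) assms(1,5) by (intro mult_right_mono) (auto simp: \<delta>_def)
  also have "\<dots> = b 1 * (\<epsilon> * M / 4)"
    using assms(1) by (simp add: \<delta>_def field_simps)
  finally have "b 1 * (real N / 4 - 2 * M) \<le> b 1 * (\<epsilon> * M / 4)"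
    by (simp add: algebra_simps)
  then have "real N / 4 - 2 * M \<le> \<epsilon> * M / 4" using assms(5) by simp
  \<comment> \<open>The inequality says N \<le> (8 + \<epsilon>) * M. The 8 is the loss
    \<open>2 * M\<close> measured against the gain \<open>N / 4\<close>; the \<epsilon> is the room
    left for \<delta>.\<close>
  then show False using N_floor(2) by (simp add: algebra_simps)
qed

end
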